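(* Let $A\in\mathbb{C}^{n\times n}$ be diagonalizable, $A=V\Lambda V^{-1}$ with $\Lambda$ diagonal and $V=[v_1\cdots v_n]$ invertible. Let $\Omega\subset\{1,\ldots,n\}$ have $K$ elements and let $V_\Omega\in\mathbb{C}^{n\times K}$ be the matrix with columns $\{v_k\}_{k\in\Omega}$. Let $M\subset\{1,\ldots,n\}$ be a set of $m$ sampled vertices, and let $P_M\in\{0,1\}^{m\times n}$ be the restriction operator to $M$. Suppose $x=V_\Omega c$ for some $c\in\mathbb{C}^K$, that $P_MV_\Omega$ has full column rank $K$, and that $y=P_Mx+\eta$ with $\eta\in\mathbb{C}^m$. Then the least-squares reconstruction $\hat{x}=V_\Omega\hat{c}$, $\hat{c}=(P_MV_\Omega)^\dagger y$, satisfies $$\|\hat{x}-x\|_2\le\|V_\Omega\|_2\,\|(P_MV_\Omega)^\dagger\|_2\,\|\eta\|_2=\|V_\Omega\|_2\,\frac{\|\eta\|_2}{\sigma_{\min}(P_MV_\Omega)}.$$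
   Context: The vertex set of the graph is $\{1,\ldots,n\}$ and a signal is a vector in $\mathbb{C}^n$. The restriction operator $P_M$ maps $x\in\mathbb{C}^n$ to the vector $(x_i)_{i\in M}\in\mathbb{C}^m$ of its entries at the vertices in $M$. $B^\dagger$ denotes the Moore–Penrose pseudoinverse of $B$; $\|\cdot\|_2$ is the Euclidean norm on vectors and the spectral (operator) norm on matrices; $\sigma_{\min}(P_MV_\Omega)$ is the smallest singular value of the $m\times K$ matrix $P_MV_\Omega$, i.e. the smallest of its $K$ singular values ($K\ge 1$). *)

theory Defs
  imports
    "HOL-Analysis.L2_Norm"
    "Jordan_Normal_Form.Schur_Decomposition"
    "Jordan_Normal_Form.Spectral_Radius"
    "Jordan_Normal_Form.DL_Rank"
    "Jordan_Normal_Form.DL_Submatrix"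
begin

text \<open>Vectors and matrices are those of Jordan_Normal_Form, with indices starting at 0: the vertex
  set of the graph is \<open>{0..<n}\<close>. Entries indexed by a set of vertices are listed in increasing
  order of the vertices; \<^term>\<open>pick S i\<close> is the element number \<open>i\<close> of \<open>S\<close>.\<close>

definition vec_norm2 :: "complex vec \<Rightarrow> real" where
  "vec_norm2 v = L2_set (\<lambda>i. cmod (v $ i)) {..<dim_vec v}"

definition spectral_norm :: "complex mat \<Rightarrow> real" where
  "spectral_norm A = (SUP v\<in>{v \<in> carrier_vec (dim_col A). vec_norm2 v \<le> 1}. vec_norm2 (A *\<^sub>v v))"

definition restriction_mat :: "nat \<Rightarrow> nat set \<Rightarrow> complex mat" where
  "restriction_mat n M = mat (card M) n (\<lambda>(i, j). if j = pick M i then 1 else 0)"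

definition select_cols :: "complex mat \<Rightarrow> nat set \<Rightarrow> complex mat" where
  "select_cols V \<Omega> = submatrix V UNIV \<Omega>"

text \<open>The four Penrose conditions.\<close>

definition is_pseudoinverse :: "complex mat \<Rightarrow> complex mat \<Rightarrow> bool" where
  "is_pseudoinverse B X \<longleftrightarrow>
     X \<in> carrier_mat (dim_col B) (dim_row B) \<and>
     B * X * B = B \<and> X * B * X = X \<and>
     mat_adjoint (B * X) = B * X \<and> mat_adjoint (X * B) = X * B"

definition pseudoinverse :: "complex mat \<Rightarrow> complex mat" where
  "pseudoinverse B = (THE X. is_pseudoinverse B X)"

text \<open>The singular values of an \<open>m \<times> K\<close> matrix \<open>B\<close> are the nonnegative square roots of the \<open>K\<close>
  eigenvalues of \<open>B\<^sup>* B\<close>, so that \<open>0\<close> is one of them when \<open>m < K\<close>. Multiplicities are dropped,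
  which does not affect the smallest one.\<close>

definition singular_values :: "complex mat \<Rightarrow> real set" where
  "singular_values B = {s. 0 \<le> s \<and> complex_of_real (s\<^sup>2) \<in> spectrum (mat_adjoint B * B)}"

definition sigma_min :: "complex mat \<Rightarrow> real" where
  "sigma_min B = Min (singular_values B)"

lemma restriction_mat_mult_vec:
  assumes M: "M \<subseteq> {0..<n}" and x: "x \<in> carrier_vec n"
  shows "restriction_mat n M *\<^sub>v x = vec (card M) (\<lambda>i. x $ pick M i)"
proof (rule eq_vecI)
  fix i assume "i < dim_vec (vec (card M) (\<lambda>i. x $ pick M i))"
  then have i: "i < card M" by simp
  have fin: "finite M" using M finite_subset by blast
  have p: "pick M i < n" using pick_in_set_le[OF i] M by auto
  have "(restriction_mat n M *\<^sub>v x) $ i = (\<Sum>j = 0..<n. (if j = pick M i then 1 else 0) * x $ j)"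
    using i x by (simp add: restriction_mat_def scalar_prod_def)
  also have "\<dots> = (\<Sum>j = 0..<n. if j = pick M i then x $ j else 0)"
    by (rule sum.cong) auto
  also have "\<dots> = x $ pick M i" using p by simp
  finally show "(restriction_mat n M *\<^sub>v x) $ i = vec (card M) (\<lambda>i. x $ pick M i) $ i"
    using i by simp
qed (simp add: restriction_mat_def)

lemma select_cols_col:
  assumes \<Omega>: "\<Omega> \<subseteq> {0..<dim_col V}" and j: "j < card \<Omega>"
  shows "dim_col (select_cols V \<Omega>) = card \<Omega>" "dim_row (select_cols V \<Omega>) = dim_row V"
    and "col (select_cols V \<Omega>) j = col V (pick \<Omega> j)"
proof -
  have e: "{j. j < dim_col V \<and> j \<in> \<Omega>} = \<Omega>" using \<Omega> by auto
  show 1: "dim_col (select_cols V \<Omega>) = card \<Omega>" "dim_row (select_cols V \<Omega>) = dim_row V"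
    by (simp_all add: select_cols_def dim_submatrix e)
  have p: "pick \<Omega> j < dim_col V" using pick_in_set_le[OF j] \<Omega> by auto
  show "col (select_cols V \<Omega>) j = col V (pick \<Omega> j)"
    using j p by (intro eq_vecI) (simp_all add: select_cols_def submatrix_def e pick_UNIV)
qed

text \<open>A matrix has at most one pseudoinverse, so the description in \<^term>\<open>pseudoinverse\<close> is proper.\<close>

lemma mat_adjoint_index:
  assumes "i < dim_col A" "j < dim_row A"
  shows "mat_adjoint A $$ (i, j) = conjugate (A $$ (j, i))"
  using assms by (simp add: mat_adjoint_def mat_of_rows_def)

lemma mat_adjoint_dim:
  "dim_row (mat_adjoint A) = dim_col A" "dim_col (mat_adjoint A) = dim_row A"
  by (simp_all add: mat_adjoint_def mat_of_rows_def)

lemma mat_adjoint_mult: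
  fixes A B :: "complex mat"
  assumes A: "A \<in> carrier_mat a b" and B: "B \<in> carrier_mat b d"
  shows "mat_adjoint (A * B) = mat_adjoint B * mat_adjoint A"
  using A B
  by (intro eq_matI)
    (auto simp: mat_adjoint_index mat_adjoint_dim scalar_prod_def mult.commute intro!: sum.cong)

lemma is_pseudoinverse_unique:
  assumes X: "is_pseudoinverse B X" and Y: "is_pseudoinverse B Y"
  shows "X = Y"
proof -
  define m k where "m = dim_row B" and "k = dim_col B"
  have c: "B \<in> carrier_mat m k" "X \<in> carrier_mat k m" "Y \<in> carrier_mat k m"
    using X Y by (auto simp: is_pseudoinverse_def m_def k_def)
  note d = c mult_carrier_mat[OF c(1,2)] mult_carrier_mat[OF c(1,3)]
    mult_carrier_mat[OF c(2,1)] mult_carrier_mat[OF c(3,1)]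
  have x: "B * X * B = B" "X * B * X = X" "mat_adjoint (B * X) = B * X" "mat_adjoint (X * B) = X * B"
    and y: "B * Y * B = B" "Y * B * Y = Y" "mat_adjoint (B * Y) = B * Y" "mat_adjoint (Y * B) = Y * B"
    using X Y by (auto simp: is_pseudoinverse_def)
  have "B * X = mat_adjoint (B * Y * B * X)" by (simp add: x y)
  also have "B * Y * B * X = (B * Y) * (B * X)" using d by (intro assoc_mult_mat)
  also have "mat_adjoint \<dots> = (B * X) * (B * Y)"
    using mat_adjoint_mult[OF d(5,4)] by (simp only: x y)
  also have "\<dots> = B * X * B * Y" using d by (intro assoc_mult_mat[symmetric])
  finally have 1: "B * X = B * Y" by (simp add: x)
  have "X * B = mat_adjoint (X * (B * Y * B))" by (simp add: x y)
  also have "X * (B * Y * B) = X * (B * (Y * B))" using assoc_mult_mat[OF d(1,3,1)] by simp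
  also have "\<dots> = (X * B) * (Y * B)" using d by (intro assoc_mult_mat[symmetric])
  also have "mat_adjoint \<dots> = (Y * B) * (X * B)"
    using mat_adjoint_mult[OF d(6,7)] by (simp only: x y)
  also have "\<dots> = Y * (B * (X * B))" using d by (intro assoc_mult_mat)
  also have "B * (X * B) = B * X * B" using assoc_mult_mat[OF d(1,2,1)] by simp
  finally have 2: "X * B = Y * B" by (simp add: x)
  have "X = X * B * X" by (simp add: x)
  also have "\<dots> = Y * (B * X)" using assoc_mult_mat[OF d(3,1,2)] by (simp add: 2)
  also have "\<dots> = Y * B * Y" using assoc_mult_mat[OF d(3,1,3)] by (simp add: 1)
  finally show ?thesis by (simp add: y)
qed

end

theory Submission
  imports "HOL-Analysis.Function_Topology" "HOL-Analysis.Topology_Euclidean_Space" Defs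
begin

text \<open>Write \<open>B = P\<^sub>M V\<^sub>\<Omega>\<close> and \<open>X = B\<^sup>\<dagger>\<close>. Full column rank makes \<open>X\<close> a left inverse of \<open>B\<close>, so the
  reconstruction recovers \<open>c\<close> exactly from the clean samples \<open>B c\<close>, and the error that remains is
  \<open>V\<^sub>\<Omega> X \<eta>\<close>. The inequality is then submultiplicativity of the spectral norm
  (\<open>vec_norm2_mult_le_spectral_norm\<close>, applied twice).

  The equality says \<open>\<parallel>X\<parallel> = 1 / \<sigma>\<close> for \<open>\<sigma> = \<sigma>\<^sub>m\<^sub>i\<^sub>n(B)\<close>. It rests on the variational description of \<open>\<sigma>\<close>
  (\<open>sigma_min_attained\<close>): \<open>\<sigma>\<close> is the minimum of \<open>\<parallel>B v\<parallel>\<close> over the unit sphere. That minimum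
  exists by compactness, and perturbing a minimizer \<open>v\<close> shows that it is an eigenvector of \<open>B\<^sup>* B\<close> for
  the eigenvalue \<open>\<parallel>B v\<parallel>\<^sup>2\<close>; conversely a unit eigenvector for an eigenvalue \<open>s\<^sup>2\<close> has
  \<open>\<parallel>B v\<parallel> = s\<close>, so no singular value lies below the minimum. In this way the spectral theorem
  is avoided: only the smallest eigenvalue of \<open>B\<^sup>* B\<close> matters.

  Since \<open>B X\<close> is an orthogonal projection,
  \<open>\<sigma> \<parallel>X w\<parallel> \<le> \<parallel>B X w\<parallel> \<le> \<parallel>w\<parallel>\<close>, so \<open>\<parallel>X\<parallel> \<le> 1 / \<sigma>\<close>; the vector \<open>w = B v\<close> of
  norm \<open>\<sigma>\<close>, which \<open>X\<close> sends back to the unit vector \<open>v\<close>, gives the reverse inequality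
  (\<open>spectral_norm_pseudoinverse\<close>).\<close>

section \<open>The Euclidean norm and its inner product\<close>

lemma vec_norm2_nonneg [simp]: "0 \<le> vec_norm2 v"
  by (simp add: vec_norm2_def)

lemma vec_norm2_eq_0_iff:
  assumes "v \<in> carrier_vec k"
  shows "vec_norm2 v = 0 \<longleftrightarrow> v = 0\<^sub>v k"
  using assms by (auto simp: vec_norm2_def L2_set_eq_0_iff)

lemma vec_norm2_smult: "vec_norm2 (a \<cdot>\<^sub>v v) = cmod a * vec_norm2 v"
  by (simp add: vec_norm2_def norm_mult L2_set_right_distrib cong: L2_set_cong_simp)

lemma cscalar_prod_self: "v \<bullet>c v = complex_of_real ((vec_norm2 v)\<^sup>2)"
  by (simp add: vec_norm2_def L2_set_def sum_nonneg scalar_prod_def complex_norm_square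
      lessThan_atLeast0 del: of_real_power)

lemma vec_norm2_sq: "(vec_norm2 v)\<^sup>2 = Re (v \<bullet>c v)"
  by (simp add: cscalar_prod_self)

lemma cmod_cscalar_prod_le:
  assumes "u \<in> carrier_vec k" "v \<in> carrier_vec k"
  shows "cmod (u \<bullet>c v) \<le> vec_norm2 u * vec_norm2 v"
proof -
  have "cmod (u \<bullet>c v) \<le> (\<Sum>i<k. \<bar>cmod (u $ i)\<bar> * \<bar>cmod (v $ i)\<bar>)"
    using assms by (auto simp: scalar_prod_def lessThan_atLeast0 norm_mult intro!: sum_norm_le)
  also have "\<dots> \<le> vec_norm2 u * vec_norm2 v"
    using L2_set_mult_ineq[of "\<lambda>i. cmod (u $ i)" "\<lambda>i. cmod (v $ i)" "{..<k}"] assms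
    by (auto simp: vec_norm2_def)
  finally show ?thesis .
qed

lemma vec_norm2_add_smult_sq:
  assumes "a \<in> carrier_vec k" "b \<in> carrier_vec k"
  shows "(vec_norm2 (a + complex_of_real t \<cdot>\<^sub>v b))\<^sup>2
    = (vec_norm2 a)\<^sup>2 + 2 * t * Re (a \<bullet>c b) + t\<^sup>2 * (vec_norm2 b)\<^sup>2"
proof -
  have "(vec_norm2 (a + complex_of_real t \<cdot>\<^sub>v b))\<^sup>2
      = (\<Sum>i<k. (cmod (a $ i + complex_of_real t * b $ i))\<^sup>2)"
    using assms by (simp add: vec_norm2_def L2_set_def sum_nonneg)
  also have "\<dots> = (\<Sum>i<k. (cmod (a $ i))\<^sup>2 + 2 * t * Re (a $ i * cnj (b $ i)) + t\<^sup>2 * (cmod (b $ i))\<^sup>2)"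
    by (intro sum.cong refl) (simp add: cmod_power2, simp add: power2_eq_square algebra_simps)
  also have "\<dots> = (vec_norm2 a)\<^sup>2 + 2 * t * Re (a \<bullet>c b) + t\<^sup>2 * (vec_norm2 b)\<^sup>2"
    using assms by (simp add: vec_norm2_def L2_set_def sum_nonneg scalar_prod_def lessThan_atLeast0
        sum.distrib sum_distrib_left distrib_left)
  finally show ?thesis .
qed

lemma mat_adjoint_carrier: "A \<in> carrier_mat m k \<Longrightarrow> mat_adjoint A \<in> carrier_mat k m"
  by (auto simp: mat_adjoint_dim)

lemma mat_adjoint_adjoint: "mat_adjoint (mat_adjoint A) = A"
  by (intro eq_matI) (auto simp: mat_adjoint_dim mat_adjoint_index)

lemma mat_adjoint_one: "mat_adjoint (1\<^sub>m k) = (1\<^sub>m k :: complex mat)"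
  by (intro eq_matI) (auto simp: mat_adjoint_dim mat_adjoint_index)

lemma adjoint_cscalar_prod:
  fixes A :: "complex mat"
  assumes "A \<in> carrier_mat m k" "w \<in> carrier_vec m" "u \<in> carrier_vec k"
  shows "(mat_adjoint A *\<^sub>v w) \<bullet>c u = w \<bullet>c (A *\<^sub>v u)"
proof -
  have "(mat_adjoint A *\<^sub>v w) \<bullet>c u = (\<Sum>j=0..<k. \<Sum>i=0..<m. cnj (A $$ (i,j)) * w $ i * cnj (u $ j))"
    using assms by (auto simp: scalar_prod_def mat_adjoint_dim mat_adjoint_index sum_distrib_right
        intro!: sum.cong)
  also have "\<dots> = (\<Sum>i=0..<m. \<Sum>j=0..<k. cnj (A $$ (i,j)) * w $ i * cnj (u $ j))"
    by (rule sum.swap)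
  also have "\<dots> = w \<bullet>c (A *\<^sub>v u)"
    using assms by (auto simp: scalar_prod_def sum_distrib_left ac_simps intro!: sum.cong)
  finally show ?thesis .
qed

lemma vec_norm2_mult_sq:
  fixes A :: "complex mat"
  assumes A: "A \<in> carrier_mat m k" and v: "v \<in> carrier_vec k"
  shows "(vec_norm2 (A *\<^sub>v v))\<^sup>2 = Re (((mat_adjoint A * A) *\<^sub>v v) \<bullet>c v)"
  using adjoint_cscalar_prod[OF A mult_mat_vec_carrier[OF A v] v]
    assoc_mult_mat_vec[OF mat_adjoint_carrier[OF A] A v] by (simp add: vec_norm2_sq)

section \<open>The spectral norm\<close>

text \<open>The crude bound by the sum of the moduli of all entries is there only to make the supremum in
  the definition of the spectral norm a supremum of a bounded set.\<close>

lemma vec_norm2_mult_le_sum: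
  assumes A: "A \<in> carrier_mat m k" and v: "v \<in> carrier_vec k" and v1: "vec_norm2 v \<le> 1"
  shows "vec_norm2 (A *\<^sub>v v) \<le> (\<Sum>i<m. \<Sum>j<k. cmod (A $$ (i,j)))"
proof -
  have v_le: "cmod (v $ j) \<le> 1" if "j < k" for j
    using member_le_L2_set[of "{..<k}" j "\<lambda>j. cmod (v $ j)"] that v v1 by (auto simp: vec_norm2_def)
  have "vec_norm2 (A *\<^sub>v v) \<le> (\<Sum>i<m. cmod ((A *\<^sub>v v) $ i))"
    using L2_set_le_sum[of "{..<m}" "\<lambda>i. cmod ((A *\<^sub>v v) $ i)"] A by (simp add: vec_norm2_def)
  also have "\<dots> \<le> (\<Sum>i<m. \<Sum>j<k. cmod (A $$ (i,j)))"
  proof (rule sum_mono)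
    fix i assume "i \<in> {..<m}"
    then have "(A *\<^sub>v v) $ i = (\<Sum>j<k. A $$ (i,j) * v $ j)"
      using A v by (simp add: scalar_prod_def lessThan_atLeast0)
    then show "cmod ((A *\<^sub>v v) $ i) \<le> (\<Sum>j<k. cmod (A $$ (i,j)))"
      using v_le by (auto simp: norm_mult intro!: sum_norm_le mult_left_le)
  qed
  finally show ?thesis .
qed

lemma vec_norm2_mult_le_spectral_norm:
  assumes A: "A \<in> carrier_mat m k" and v: "v \<in> carrier_vec k"
  shows "vec_norm2 (A *\<^sub>v v) \<le> spectral_norm A * vec_norm2 v"
proof (cases "vec_norm2 v = 0")
  case True
  then have "A *\<^sub>v v = 0\<^sub>v m"
    using A v by (auto simp: vec_norm2_eq_0_iff[OF v])
  then show ?thesis using True vec_norm2_eq_0_iff[of "A *\<^sub>v v" m] by simp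
next
  case False
  define s where "s = vec_norm2 v"
  have s: "s > 0" using False by (simp add: s_def less_le)
  define w where "w = complex_of_real (1 / s) \<cdot>\<^sub>v v"
  have w: "w \<in> carrier_vec k" "vec_norm2 w \<le> 1"
    using v s by (auto simp: w_def vec_norm2_smult s_def norm_divide)
  have "vec_norm2 (A *\<^sub>v w) \<le> spectral_norm A"
    unfolding spectral_norm_def
  proof (rule cSUP_upper)
    show "w \<in> {v \<in> carrier_vec (dim_col A). vec_norm2 v \<le> 1}" using w A by auto
    show "bdd_above ((\<lambda>v. vec_norm2 (A *\<^sub>v v)) ` {v \<in> carrier_vec (dim_col A). vec_norm2 v \<le> 1})"
      using vec_norm2_mult_le_sum[OF A] A by (intro bdd_aboveI2) auto
  qed
  moreover have "A *\<^sub>v w = complex_of_real (1 / s) \<cdot>\<^sub>v (A *\<^sub>v v)"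
    unfolding w_def by (rule mult_mat_vec[OF A v])
  ultimately show ?thesis
    using s by (simp add: vec_norm2_smult norm_divide s_def[symmetric] divide_le_eq)
qed

lemma spectral_norm_nonneg: "0 \<le> spectral_norm A"
proof -
  have z: "vec_norm2 (0\<^sub>v k) = 0" for k by (simp add: vec_norm2_eq_0_iff[of _ k])
  have "vec_norm2 (A *\<^sub>v 0\<^sub>v (dim_col A)) \<le> spectral_norm A"
    unfolding spectral_norm_def
  proof (rule cSUP_upper)
    show "bdd_above ((\<lambda>v. vec_norm2 (A *\<^sub>v v)) ` {v \<in> carrier_vec (dim_col A). vec_norm2 v \<le> 1})"
      using vec_norm2_mult_le_sum[of A "dim_row A" "dim_col A"] by (intro bdd_aboveI2) auto
  qed (simp add: z)
  then show ?thesis using vec_norm2_nonneg order_trans by blast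
qed

section \<open>The smallest singular value\<close>

text \<open>The continuous function \<open>v \<mapsto> \<parallel>B v\<parallel>\<close> attains its minimum on the compact unit sphere. To have a
  topology at hand, the sphere is modelled by functions \<open>nat \<Rightarrow> complex\<close> that vanish from index \<open>k\<close>
  on: in the product topology it is a closed subset of a product of discs and points, which is
  compact by Tychonoff. The minimality is stated in the homogeneous form that holds for vectors of
  every length.\<close>

lemma exists_unit_minimizer:
  assumes B: "B \<in> carrier_mat m k" and k: "k \<ge> 1"
  obtains v where "v \<in> carrier_vec k" "vec_norm2 v = 1"
    "\<And>w. w \<in> carrier_vec k \<Longrightarrow> vec_norm2 (B *\<^sub>v v) * vec_norm2 w \<le> vec_norm2 (B *\<^sub>v w)"
proof -
  define S :: "(nat \<Rightarrow> complex) set"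
    where "S = (\<Pi>\<^sub>E i\<in>UNIV. if i < k then cball 0 1 else {0}) \<inter> {f. vec_norm2 (vec k f) = 1}"
  define g where "g f = vec_norm2 (B *\<^sub>v vec k f)" for f :: "nat \<Rightarrow> complex"
  have g_eq: "g f = sqrt (\<Sum>i<m. (cmod (\<Sum>j<k. B $$ (i,j) * f j))\<^sup>2)" for f
    using B by (simp add: g_def vec_norm2_def L2_set_def scalar_prod_def lessThan_atLeast0)
  have n_eq: "vec_norm2 (vec k f) = sqrt (\<Sum>j<k. (cmod (f j))\<^sup>2)" for f
    by (simp add: vec_norm2_def L2_set_def)
  have "compact (\<Pi>\<^sub>E i\<in>(UNIV::nat set). if i < k then cball 0 1 else {0::complex})"
    using compactin_PiE[of "\<lambda>_::nat. euclidean :: complex topology" UNIV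
        "\<lambda>i. if i < k then cball 0 1 else {0}"]
    by (simp add: euclidean_product_topology compactin_euclidean_iff)
  moreover have "closed {f :: nat \<Rightarrow> complex. vec_norm2 (vec k f) = 1}"
    unfolding n_eq by (intro closed_Collect_eq continuous_intros continuous_on_product_coordinates)
  ultimately have "compact S" unfolding S_def by (rule compact_Int_closed)
  moreover have "(\<lambda>i. if i = 0 then 1 else 0) \<in> S"
    using k by (auto simp: S_def n_eq if_distrib[of cmod] if_distrib[of "\<lambda>x. x\<^sup>2"] cong: if_cong)
  then have "S \<noteq> {}" by auto
  moreover have "continuous_on S g"
    unfolding g_eq by (intro continuous_intros continuous_on_subset[OF continuous_on_product_coordinates]) auto
  ultimately obtain f where f: "f \<in> S" and min: "\<And>h. h \<in> S \<Longrightarrow> g f \<le> g h"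
    using continuous_attains_inf by metis
  show thesis
  proof
    show "vec k f \<in> carrier_vec k" by simp
    show "vec_norm2 (vec k f) = 1" using f by (simp add: S_def)
    fix w :: "complex vec" assume w: "w \<in> carrier_vec k"
    show "vec_norm2 (B *\<^sub>v vec k f) * vec_norm2 w \<le> vec_norm2 (B *\<^sub>v w)"
    proof (cases "vec_norm2 w = 0")
      case False
      define s where "s = vec_norm2 w"
      have s: "s > 0" using False by (simp add: s_def less_le)
      define u where "u = complex_of_real (1 / s) \<cdot>\<^sub>v w"
      define h where "h i = (if i < k then u $ i else 0)" for i
      have u: "u \<in> carrier_vec k" "vec_norm2 u = 1"
        using w s by (auto simp: u_def vec_norm2_smult s_def norm_divide)
      have hu: "vec k h = u" using u by (intro eq_vecI) (auto simp: h_def)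
      have "cmod (u $ j) \<le> 1" if "j < k" for j
        using member_le_L2_set[of "{..<k}" j "\<lambda>j. cmod (u $ j)"] that u by (auto simp: vec_norm2_def)
      then have "h \<in> S" using u by (auto simp: S_def hu) (auto simp: h_def)
      from min[OF this] have "vec_norm2 (B *\<^sub>v vec k f) \<le> vec_norm2 (B *\<^sub>v u)"
        by (simp add: g_def hu)
      also have "B *\<^sub>v u = complex_of_real (1 / s) \<cdot>\<^sub>v (B *\<^sub>v w)"
        unfolding u_def by (rule mult_mat_vec[OF B w])
      finally show ?thesis
        using s by (simp add: vec_norm2_smult norm_divide s_def[symmetric] le_divide_eq)
    qed simp
  qed
qed

text \<open>For small \<open>t\<close> of sign opposite to \<open>a\<close> the linear term dominates.\<close>

lemma linear_coeff_zero_if_quadratic_nonneg: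
  fixes a b :: real
  assumes nn: "\<And>t. 0 \<le> 2 * t * a + t\<^sup>2 * b"
  shows "a = 0"
proof (rule ccontr)
  assume a: "a \<noteq> 0"
  \<comment> \<open>Any \<open>d\<close> that is positive and at least \<open>b\<close> would do; then \<open>t = - a / d\<close> gives at most \<open>- a\<^sup>2 / d\<close>.\<close>
  define d where "d = \<bar>b\<bar> + 1"
  have d: "d > 0" "b \<le> d" by (auto simp: d_def)
  have "0 \<le> 2 * (- a / d) * a + (- a / d)\<^sup>2 * b" by (rule nn)
  also have "\<dots> \<le> 2 * (- a / d) * a + (- a / d)\<^sup>2 * d"
    using d by (intro add_left_mono mult_left_mono) auto
  also have "\<dots> = - (a\<^sup>2 / d)" using d by (simp add: field_simps power2_eq_square)
  also have "\<dots> < 0" using a d by simp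
  finally show False by simp
qed

text \<open>The form \<open>q(w) = \<parallel>B w\<parallel>\<^sup>2 - \<mu> \<parallel>w\<parallel>\<^sup>2\<close> with \<open>\<mu> = \<parallel>B v\<parallel>\<^sup>2\<close> is nonnegative and vanishes at
  \<open>v\<close>. Moving from \<open>v\<close> in the direction of its gradient \<open>u = (B\<^sup>* B - \<mu>) v\<close> gives
  \<open>q(v + t u) = 2 t \<parallel>u\<parallel>\<^sup>2 + t\<^sup>2 q(u)\<close>, which is nonnegative for all real \<open>t\<close> only if \<open>u = 0\<close>.\<close>

lemma minimizer_is_eigenvector:
  assumes B: "B \<in> carrier_mat m k" and v: "v \<in> carrier_vec k" and v1: "vec_norm2 v = 1"
    and min: "\<And>w. w \<in> carrier_vec k \<Longrightarrow> vec_norm2 (B *\<^sub>v v) * vec_norm2 w \<le> vec_norm2 (B *\<^sub>v w)"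
  shows "(mat_adjoint B * B) *\<^sub>v v = complex_of_real ((vec_norm2 (B *\<^sub>v v))\<^sup>2) \<cdot>\<^sub>v v"
proof -
  define \<mu> where "\<mu> = (vec_norm2 (B *\<^sub>v v))\<^sup>2"
  define Gv where "Gv = mat_adjoint B *\<^sub>v (B *\<^sub>v v)"
  define u where "u = Gv - complex_of_real \<mu> \<cdot>\<^sub>v v"
  have Bv: "B *\<^sub>v v \<in> carrier_vec m" using B v by simp
  have Gv: "Gv \<in> carrier_vec k"
    unfolding Gv_def using Bv mat_adjoint_carrier[OF B] by simp
  have u: "u \<in> carrier_vec k" using Gv v by (simp add: u_def)
  have Bu: "B *\<^sub>v u \<in> carrier_vec m" using B u by simp
  have uu: "Re ((B *\<^sub>v v) \<bullet>c (B *\<^sub>v u)) - \<mu> * Re (v \<bullet>c u) = (vec_norm2 u)\<^sup>2"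
  proof -
    have "u \<bullet>c u = Gv \<bullet>c u - complex_of_real \<mu> * (v \<bullet>c u)"
      using Gv v u unfolding u_def
      by (subst minus_scalar_prod_distrib[where n = k]) (auto simp: u_def[symmetric])
    moreover have "Gv \<bullet>c u = (B *\<^sub>v v) \<bullet>c (B *\<^sub>v u)"
      unfolding Gv_def by (rule adjoint_cscalar_prod[OF B Bv u])
    ultimately show ?thesis by (simp add: vec_norm2_sq)
  qed
  have "0 \<le> 2 * t * (vec_norm2 u)\<^sup>2 + t\<^sup>2 * ((vec_norm2 (B *\<^sub>v u))\<^sup>2 - \<mu> * (vec_norm2 u)\<^sup>2)" for t
  proof -
    let ?w = "v + complex_of_real t \<cdot>\<^sub>v u"
    have w: "?w \<in> carrier_vec k" using v u by simp
    have "B *\<^sub>v ?w = B *\<^sub>v v + complex_of_real t \<cdot>\<^sub>v (B *\<^sub>v u)"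
      using B v u by (simp add: mult_add_distrib_mat_vec[OF B] mult_mat_vec[OF B u])
    moreover have "\<mu> * (vec_norm2 ?w)\<^sup>2 \<le> (vec_norm2 (B *\<^sub>v ?w))\<^sup>2"
      using power_mono[OF min[OF w], of 2] by (simp add: \<mu>_def power_mult_distrib)
    ultimately have "\<mu> * (1 + 2 * t * Re (v \<bullet>c u) + t\<^sup>2 * (vec_norm2 u)\<^sup>2)
        \<le> \<mu> + 2 * t * Re ((B *\<^sub>v v) \<bullet>c (B *\<^sub>v u)) + t\<^sup>2 * (vec_norm2 (B *\<^sub>v u))\<^sup>2"
      by (simp add: vec_norm2_add_smult_sq[OF v u] vec_norm2_add_smult_sq[OF Bv Bu] v1 \<mu>_def)
    then show ?thesis unfolding uu[symmetric] by (simp add: algebra_simps)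
  qed
  then have "(vec_norm2 u)\<^sup>2 = 0" by (rule linear_coeff_zero_if_quadratic_nonneg)
  then have u0: "u = 0\<^sub>v k" using vec_norm2_eq_0_iff[OF u] by simp
  have "Gv = complex_of_real \<mu> \<cdot>\<^sub>v v"
  proof (rule eq_vecI)
    fix i assume "i < dim_vec (complex_of_real \<mu> \<cdot>\<^sub>v v)"
    then have "i < k" using v by simp
    then show "Gv $ i = (complex_of_real \<mu> \<cdot>\<^sub>v v) $ i"
      using arg_cong[OF u0, of "\<lambda>x. x $ i"] Gv v by (simp add: u_def)
  qed (use Gv v in simp)
  then show ?thesis
    unfolding Gv_def \<mu>_def using assoc_mult_mat_vec[OF mat_adjoint_carrier[OF B] B v] by simp
qed

text \<open>The norm \<open>\<parallel>B v\<parallel>\<close> at a minimizer is a singular value because \<open>v\<close> is an eigenvector of \<open>B\<^sup>* B\<close>,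
  and a smallest one because an eigenvector \<open>w\<close> for \<open>s\<^sup>2\<close> satisfies \<open>\<parallel>B w\<parallel> = s \<parallel>w\<parallel>\<close>.\<close>

lemma sigma_min_attained:
  assumes B: "B \<in> carrier_mat m k" and k: "k \<ge> 1"
  obtains v where "v \<in> carrier_vec k" "vec_norm2 v = 1" "vec_norm2 (B *\<^sub>v v) = sigma_min B"
    "\<And>w. w \<in> carrier_vec k \<Longrightarrow> sigma_min B * vec_norm2 w \<le> vec_norm2 (B *\<^sub>v w)"
proof -
  obtain v where v: "v \<in> carrier_vec k" "vec_norm2 v = 1"
    and min: "\<And>w. w \<in> carrier_vec k \<Longrightarrow> vec_norm2 (B *\<^sub>v v) * vec_norm2 w \<le> vec_norm2 (B *\<^sub>v w)"
    using exists_unit_minimizer[OF B k] by metis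
  let ?G = "mat_adjoint B * B"
  have G: "?G \<in> carrier_mat k k" using B mat_adjoint_carrier[OF B] by simp
  have v0: "v \<noteq> 0\<^sub>v k" using v vec_norm2_eq_0_iff[OF v(1)] by auto
  have "eigenvector ?G v (complex_of_real ((vec_norm2 (B *\<^sub>v v))\<^sup>2))"
    unfolding eigenvector_def using minimizer_is_eigenvector[OF B v min] G v v0 B
    by (simp add: mat_adjoint_dim)
  then have mem: "vec_norm2 (B *\<^sub>v v) \<in> singular_values B"
    by (auto simp: singular_values_def spectrum_def eigenvalue_def)
  have le: "vec_norm2 (B *\<^sub>v v) \<le> s" if "s \<in> singular_values B" for s
  proof -
    from that obtain w where s: "0 \<le> s" and w: "w \<in> carrier_vec k" "w \<noteq> 0\<^sub>v k"
      and ew: "?G *\<^sub>v w = complex_of_real (s\<^sup>2) \<cdot>\<^sub>v w"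
      using B by (auto simp: singular_values_def spectrum_def eigenvalue_def eigenvector_def
          mat_adjoint_dim)
    have pos: "vec_norm2 w > 0" using w vec_norm2_eq_0_iff[OF w(1)] by (simp add: less_le)
    have "(vec_norm2 (B *\<^sub>v w))\<^sup>2 = (s * vec_norm2 w)\<^sup>2"
      unfolding vec_norm2_mult_sq[OF B w(1)] ew using w
      by (simp add: cscalar_prod_self power_mult_distrib)
    then have "vec_norm2 (B *\<^sub>v w) = s * vec_norm2 w"
      using s by (simp add: power2_eq_iff_nonneg)
    then show ?thesis using min[OF w(1)] pos by simp
  qed
  have "finite (singular_values B)"
  proof (rule inj_on_finite)
    show "inj_on (\<lambda>s. complex_of_real (s\<^sup>2)) (singular_values B)"
      by (auto simp: inj_on_def singular_values_def power2_eq_iff_nonneg simp del: of_real_power)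
    show "(\<lambda>s. complex_of_real (s\<^sup>2)) ` singular_values B \<subseteq> spectrum ?G"
      by (auto simp: singular_values_def)
    show "finite (spectrum ?G)" by (rule card_finite_spectrum(1)[OF G])
  qed
  then have "sigma_min B = vec_norm2 (B *\<^sub>v v)"
    unfolding sigma_min_def using mem le by (intro Min_eqI) auto
  then show thesis using that[of v] v min by simp
qed

section \<open>The pseudoinverse of a matrix of full column rank\<close>

text \<open>The rank is the dimension of the span of the set of columns. If two columns coincide, this set
  has fewer than \<open>k\<close> elements, so rank \<open>k\<close> forces the columns to be distinct as well as linearly
  independent.\<close>

lemma full_column_rank_injective:
  fixes B :: "complex mat"
  assumes B: "B \<in> carrier_mat m k" and rank: "vec_space.rank m B = k"
    and v: "v \<in> carrier_vec k" and Bv: "B *\<^sub>v v = 0\<^sub>v m"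
  shows "v = 0\<^sub>v k"
proof (rule ccontr)
  assume v0: "v \<noteq> 0\<^sub>v k"
  interpret vec_space "TYPE(complex)" m .
  have dist: "distinct (cols B)"
  proof (rule ccontr)
    assume "\<not> distinct (cols B)"
    then have less: "card (set (cols B)) < k"
      using B card_distinct[of "cols B"] card_length[of "cols B"] by (auto simp: less_le)
    obtain S where S: "maximal S (\<lambda>T. T \<subseteq> set (cols B) \<and> lin_indpt T)"
      using maximal_exists_superset[of "set (cols B)" "\<lambda>T. T \<subseteq> set (cols B) \<and> lin_indpt T" "{}"]
        finite_lin_indpt2[of "{}"] by auto
    have "k = card S" using rank_card_indpt[OF B S] rank by simp
    also have "\<dots> \<le> card (set (cols B))" using S by (auto simp: maximal_def intro: card_mono)
    finally show False using less by simp
  qed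
  show False
    using full_rank_lin_indpt[OF B rank dist] lin_depI[OF B v v0 Bv dist] by contradiction
qed

text \<open>Injectivity of \<open>B\<close> makes the Gram matrix \<open>G = B\<^sup>* B\<close> invertible, because \<open>G v = 0\<close> implies
  \<open>\<parallel>B v\<parallel>\<^sup>2 = \<langle>G v, v\<rangle> = 0\<close>. The pseudoinverse is then \<open>G\<^sup>-\<^sup>1 B\<^sup>*\<close>; the only Penrose condition
  that does not follow from its being a left inverse is that \<open>B G\<^sup>-\<^sup>1 B\<^sup>*\<close> is Hermitian, and it comes
  from \<open>G\<^sup>-\<^sup>1\<close> being Hermitian.\<close>

lemma pseudoinverse_full_column_rank:
  fixes B :: "complex mat"
  assumes B: "B \<in> carrier_mat m k" and rank: "vec_space.rank m B = k"
  shows "is_pseudoinverse B (pseudoinverse B)" and "pseudoinverse B * B = 1\<^sub>m k"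
proof -
  let ?B' = "mat_adjoint B"
  let ?G = "?B' * B"
  have B': "?B' \<in> carrier_mat k m" by (rule mat_adjoint_carrier[OF B])
  have G: "?G \<in> carrier_mat k k" using B B' by simp
  have "det ?G \<noteq> 0"
  proof
    assume "det ?G = 0"
    then obtain v where v: "v \<in> carrier_vec k" "v \<noteq> 0\<^sub>v k" "?G *\<^sub>v v = 0\<^sub>v k"
      using det_0_iff_vec_prod_zero_field[OF G] by auto
    have "(vec_norm2 (B *\<^sub>v v))\<^sup>2 = 0"
      using vec_norm2_mult_sq[OF B v(1)] v by simp
    then have "B *\<^sub>v v = 0\<^sub>v m" using vec_norm2_eq_0_iff[of "B *\<^sub>v v" m] B v by simp
    then show False using full_column_rank_injective[OF B rank v(1)] v(2) by simp
  qed
  then obtain R where R: "R \<in> carrier_mat k k" and RG: "R * ?G = 1\<^sub>m k" and GR: "?G * R = 1\<^sub>m k"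
    using det_non_zero_imp_unit[OF G] by (force simp: Units_def ring_mat_def)
  let ?R' = "mat_adjoint R"
  have R': "?R' \<in> carrier_mat k k" by (rule mat_adjoint_carrier[OF R])
  have "mat_adjoint ?G = ?G"
    using mat_adjoint_mult[OF B' B] by (simp add: mat_adjoint_adjoint)
  then have R'G: "?R' * ?G = 1\<^sub>m k"
    using mat_adjoint_mult[OF G R] GR by (simp add: mat_adjoint_one)
  have "?R' = ?R' * (?G * R)" using GR R' by simp
  also have "\<dots> = ?R' * ?G * R" by (rule assoc_mult_mat[OF R' G R, symmetric])
  finally have herm: "?R' = R" using R'G R by simp
  define X where "X = R * ?B'"
  have X: "X \<in> carrier_mat k m" using R B' by (simp add: X_def)
  have XB: "X * B = 1\<^sub>m k" unfolding X_def using assoc_mult_mat[OF R B' B] RG by simp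
  have BX: "mat_adjoint (B * X) = B * X"
    using mat_adjoint_mult[OF B X] mat_adjoint_mult[OF R B'] assoc_mult_mat[OF B R B']
    by (simp add: mat_adjoint_adjoint herm X_def)
  have pX: "is_pseudoinverse B X"
    unfolding is_pseudoinverse_def
    using B X XB BX assoc_mult_mat[OF B X B] by (auto simp: mat_adjoint_one)
  then have "pseudoinverse B = X"
    unfolding pseudoinverse_def by (intro the_equality) (auto intro: is_pseudoinverse_unique)
  then show "is_pseudoinverse B (pseudoinverse B)" "pseudoinverse B * B = 1\<^sub>m k"
    using pX XB by simp_all
qed

text \<open>By the Penrose conditions \<open>Q = B X\<close> is a Hermitian idempotent, so
  \<open>\<parallel>Q w\<parallel>\<^sup>2 = \<langle>Q w, w\<rangle> \<le> \<parallel>Q w\<parallel> \<parallel>w\<parallel>\<close>.\<close>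

lemma vec_norm2_projection_le:
  assumes B: "B \<in> carrier_mat m k" and X: "is_pseudoinverse B X" and w: "w \<in> carrier_vec m"
  shows "vec_norm2 (B *\<^sub>v (X *\<^sub>v w)) \<le> vec_norm2 w"
proof -
  let ?P = "B * X"
  have Xc: "X \<in> carrier_mat k m" using X B by (auto simp: is_pseudoinverse_def)
  have P: "?P \<in> carrier_mat m m" using B Xc by simp
  have Pw: "?P *\<^sub>v w \<in> carrier_vec m" using P w by simp
  have "?P * ?P = ?P"
    using X assoc_mult_mat[OF P B Xc] by (simp add: is_pseudoinverse_def)
  then have "(vec_norm2 (?P *\<^sub>v w))\<^sup>2 = Re ((?P *\<^sub>v w) \<bullet>c w)"
    using X vec_norm2_mult_sq[OF P w] by (simp add: is_pseudoinverse_def)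
  also have "\<dots> \<le> vec_norm2 (?P *\<^sub>v w) * vec_norm2 w"
    using complex_Re_le_cmod cmod_cscalar_prod_le[OF Pw w] order_trans by blast
  finally have "vec_norm2 (?P *\<^sub>v w) \<le> vec_norm2 w"
    by (cases "vec_norm2 (?P *\<^sub>v w) = 0") (auto simp: power2_eq_square less_le)
  then show ?thesis using assoc_mult_mat_vec[OF B Xc w] by simp
qed

text \<open>The upper bound combines \<open>\<sigma> \<parallel>u\<parallel> \<le> \<parallel>B u\<parallel>\<close> at \<open>u = X w\<close> with the contractivity of \<open>B X\<close>; the
  lower bound tests the norm on \<open>B v\<close> for a unit vector \<open>v\<close> with \<open>\<parallel>B v\<parallel> = \<sigma>\<close>. The lower bound in
  the form \<open>1 \<le> \<parallel>X\<parallel> \<sigma>\<close> also shows \<open>\<sigma> > 0\<close>.\<close>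

lemma spectral_norm_pseudoinverse:
  assumes B: "B \<in> carrier_mat m k" and k: "k \<ge> 1" and rank: "vec_space.rank m B = k"
  shows "spectral_norm (pseudoinverse B) = 1 / sigma_min B"
proof -
  let ?X = "pseudoinverse B"
  obtain v where v: "v \<in> carrier_vec k" "vec_norm2 v = 1" "vec_norm2 (B *\<^sub>v v) = sigma_min B"
    and min: "\<And>w. w \<in> carrier_vec k \<Longrightarrow> sigma_min B * vec_norm2 w \<le> vec_norm2 (B *\<^sub>v w)"
    using sigma_min_attained[OF B k] by metis
  note X = pseudoinverse_full_column_rank[OF B rank]
  have Xc: "?X \<in> carrier_mat k m" using X(1) B by (auto simp: is_pseudoinverse_def)
  have Bv: "B *\<^sub>v v \<in> carrier_vec m" using B v by simp
  have XBv: "?X *\<^sub>v (B *\<^sub>v v) = v"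
    using assoc_mult_mat_vec[OF Xc B v(1)] X(2) v by simp
  have bound: "1 \<le> spectral_norm ?X * sigma_min B"
    using vec_norm2_mult_le_spectral_norm[OF Xc Bv] by (simp add: XBv v)
  have pos: "sigma_min B > 0"
    using bound v(3) vec_norm2_nonneg[of "B *\<^sub>v v"] by (cases "sigma_min B = 0") auto
  have "spectral_norm ?X \<le> 1 / sigma_min B"
    unfolding spectral_norm_def
  proof (rule cSUP_least)
    have "0\<^sub>v m \<in> {w \<in> carrier_vec (dim_col ?X). vec_norm2 w \<le> 1}"
      using Xc vec_norm2_eq_0_iff[of "0\<^sub>v m" m] by auto
    then show "{w \<in> carrier_vec (dim_col ?X). vec_norm2 w \<le> 1} \<noteq> {}" by blast
    fix w assume "w \<in> {w \<in> carrier_vec (dim_col ?X). vec_norm2 w \<le> 1}"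
    then have w: "w \<in> carrier_vec m" "vec_norm2 w \<le> 1" using Xc by auto
    have "sigma_min B * vec_norm2 (?X *\<^sub>v w) \<le> vec_norm2 (B *\<^sub>v (?X *\<^sub>v w))"
      using Xc w by (intro min) simp
    also have "\<dots> \<le> 1" using vec_norm2_projection_le[OF B X(1) w(1)] w(2) by simp
    finally show "vec_norm2 (?X *\<^sub>v w) \<le> 1 / sigma_min B"
      using pos by (simp add: le_divide_eq mult.commute)
  qed
  moreover have "1 / sigma_min B \<le> spectral_norm ?X"
    using bound pos by (simp add: divide_le_eq)
  ultimately show ?thesis by simp
qed

section \<open>The reconstruction error\<close>

theorem theorem4p4:
  fixes n m K :: nat
    and A \<Lambda> V V' V\<Omega> P :: "complex mat"
    and \<Omega> M :: "nat set"
    and c x \<eta> y c_hat x_hat :: "complex vec"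
  assumes "A \<in> carrier_mat n n"
    and "similar_mat_wit A \<Lambda> V V'"
    and "diagonal_mat \<Lambda>"
    and "\<Omega> \<subseteq> {0..<n}" and "card \<Omega> = K" and "K \<ge> 1"
    and "M \<subseteq> {0..<n}" and "card M = m"
    and "V\<Omega> = select_cols V \<Omega>"
    and "P = restriction_mat n M"
    and "c \<in> carrier_vec K" and "x = V\<Omega> *\<^sub>v c"
    and "vec_space.rank m (P * V\<Omega>) = K"
    and "\<eta> \<in> carrier_vec m" and "y = P *\<^sub>v x + \<eta>"
    and "c_hat = pseudoinverse (P * V\<Omega>) *\<^sub>v y"
    and "x_hat = V\<Omega> *\<^sub>v c_hat"
  shows "vec_norm2 (x_hat - x)
      \<le> spectral_norm V\<Omega> * spectral_norm (pseudoinverse (P * V\<Omega>)) * vec_norm2 \<eta>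
    \<and> spectral_norm V\<Omega> * spectral_norm (pseudoinverse (P * V\<Omega>)) * vec_norm2 \<eta>
      = spectral_norm V\<Omega> * (vec_norm2 \<eta> / sigma_min (P * V\<Omega>))"
proof -
  let ?B = "P * V\<Omega>"
  let ?X = "pseudoinverse ?B"
  have V: "V \<in> carrier_mat n n"
    using similar_mat_witD2[OF assms(1,2)] by simp
  have VO: "V\<Omega> \<in> carrier_mat n K"
    using select_cols_col[of \<Omega> V 0] assms V by auto
  have P: "P \<in> carrier_mat m n" using assms by (simp add: restriction_mat_def)
  have B: "?B \<in> carrier_mat m K" using P VO by simp
  have c: "c \<in> carrier_vec K" and \<eta>: "\<eta> \<in> carrier_vec m" by fact+
  note X = pseudoinverse_full_column_rank[OF B \<open>vec_space.rank m (P * V\<Omega>) = K\<close>]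
  have Xc: "?X \<in> carrier_mat K m"
    using X(1) carrier_matD[OF B] unfolding is_pseudoinverse_def by metis
  have X\<eta>: "?X *\<^sub>v \<eta> \<in> carrier_vec K" using Xc \<eta> by simp
  have "y = ?B *\<^sub>v c + \<eta>"
    using assoc_mult_mat_vec[OF P VO c] assms by simp
  then have "c_hat = ?X *\<^sub>v (?B *\<^sub>v c) + ?X *\<^sub>v \<eta>"
    using assms mult_add_distrib_mat_vec[OF Xc _ \<eta>] B c by simp
  also have "?X *\<^sub>v (?B *\<^sub>v c) = c"
    using assoc_mult_mat_vec[OF Xc B c] X(2) c by simp
  finally have "x_hat = V\<Omega> *\<^sub>v c + V\<Omega> *\<^sub>v (?X *\<^sub>v \<eta>)"
    using assms mult_add_distrib_mat_vec[OF VO c X\<eta>] by simp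
  then have err: "x_hat - x = V\<Omega> *\<^sub>v (?X *\<^sub>v \<eta>)"
    unfolding \<open>x = V\<Omega> *\<^sub>v c\<close> using VO c X\<eta> by (intro eq_vecI) auto
  have "vec_norm2 (x_hat - x) \<le> spectral_norm V\<Omega> * vec_norm2 (?X *\<^sub>v \<eta>)"
    unfolding err by (rule vec_norm2_mult_le_spectral_norm[OF VO X\<eta>])
  also have "\<dots> \<le> spectral_norm V\<Omega> * (spectral_norm ?X * vec_norm2 \<eta>)"
    by (intro mult_left_mono vec_norm2_mult_le_spectral_norm[OF Xc \<eta>] spectral_norm_nonneg)
  finally have "vec_norm2 (x_hat - x) \<le> spectral_norm V\<Omega> * spectral_norm ?X * vec_norm2 \<eta>"
    by (simp add: mult.assoc)
  then show ?thesis
    using spectral_norm_pseudoinverse[OF B \<open>K \<ge> 1\<close> \<open>vec_space.rank m (P * V\<Omega>) = K\<close>] by simp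
qed

end
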